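(* Let $G_1$ and $G_2$ be two finite groups. Then the Radon transform is not injective on $G_1\times G_2$ if and only if it is noninjective on both $G_1$ and $G_2$ and the orders $|G_1|$ and $|G_2|$ are coprime.
   Context: For a finite group $G$ and $n\ge 2$ let $C_n$ be the cyclic group of order $n$, and let $\Gamma_n$ be the set of nontrivial homomorphisms $C_n\to G$. For $f:G\to\mathbb{C}$, $x\in G$ and $\gamma\in\Gamma_n$ put $R_nf(x,\gamma)=\sum_{t\in C_n}f(x\gamma(t))$. The Radon transform on $G$ is $Rf=(R_nf)_{n\ge2}$; it is injective on $G$ if the only $f:G\to\mathbb{C}$ with $R_nf=0$ for all $n\ge2$ is $f=0$. *)

theory Defs
  imports Complex_Main "HOL-Algebra.Elementary_Groups"
begin

(* C_n is integer_mod_group n, with carrier {0..<int n} for n \<ge> 2.  Its homomorphisms are taken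
   extensional, so that each map on the carrier is represented by exactly one HOL function. *)
definition nontrivial_homs :: "nat \<Rightarrow> ('a, 'b) monoid_scheme \<Rightarrow> (int \<Rightarrow> 'a) set" where
  "nontrivial_homs n G =
     {\<gamma> \<in> hom (integer_mod_group n) G \<inter> extensional (carrier (integer_mod_group n)).
        \<exists>t \<in> carrier (integer_mod_group n). \<gamma> t \<noteq> \<one>\<^bsub>G\<^esub>}"

definition radon_n ::
    "nat \<Rightarrow> ('a, 'b) monoid_scheme \<Rightarrow> ('a \<Rightarrow> complex) \<Rightarrow> 'a \<Rightarrow> (int \<Rightarrow> 'a) \<Rightarrow> complex" where
  "radon_n n G f x \<gamma> = (\<Sum>t \<in> carrier (integer_mod_group n). f (x \<otimes>\<^bsub>G\<^esub> \<gamma> t))"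

(* Only the values of f on the carrier of G are constrained and only these must vanish. *)
definition radon_injective :: "('a, 'b) monoid_scheme \<Rightarrow> bool" where
  "radon_injective G \<longleftrightarrow>
     (\<forall>f :: 'a \<Rightarrow> complex.
        (\<forall>n \<ge> 2. \<forall>x \<in> carrier G. \<forall>\<gamma> \<in> nontrivial_homs n G. radon_n n G f x \<gamma> = 0) \<longrightarrow>
        (\<forall>x \<in> carrier G. f x = 0))"

end

theory Submission
  imports Defs "HOL-Algebra.Sylow" "HOL-Algebra.Multiplicative_Group"
begin

text \<open>
  A homomorphism from the cyclic group of order \<open>n\<close> is determined by the image \<open>g\<close> of a generator,
  which can be any element with \<open>g\<^sup>n = 1\<close>. So a function lies in the kernel of the Radon transform
  exactly if its sums along all sequences \<open>x, xg, \<dots>, xg\<^sup>n\<^sup>-\<^sup>1\<close> with \<open>g\<^sup>n = 1\<close> and \<open>g \<noteq> 1\<close> vanish, and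
  injectivity says that this kernel is zero (\<open>radon_injective_iff_kernel_trivial\<close>).

  Suppose that \<open>f \<noteq> 0\<close> lies in the kernel for \<open>G\<^sub>1 \<times> G\<^sub>2\<close>. Both factors embed in the product, so the
  restrictions of \<open>f\<close> to translates of either factor lie in the kernel for that factor, and some
  of them are nonzero. If a prime \<open>p\<close> divided both orders, then by Cauchy's theorem the product would
  contain a copy of \<open>C\<^sub>p \<times> C\<^sub>p\<close>. The lines through a point of this plane that differ from one
  fixed line cover the point \<open>p\<close> times, and the remaining points of the plane off the fixed line
  once each. These remaining points make up full translates of the fixed line, on which \<open>f\<close> sums to
  zero. Hence \<open>p f(x) = 0\<close> for every \<open>x\<close> (\<open>radon_kernel_vanishes_if_rank_two\<close>), a contradiction.

  Conversely, let \<open>u\<close> and \<open>v\<close> be nonzero kernel elements for groups of coprime orders. Then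
  \<open>(x, y) \<mapsto> u(x) v(y)\<close> is in the kernel for the product (\<open>radon_kernel_tensor\<close>): coprimality forces
  every nontrivial cyclic subgroup of the product to contain a nontrivial element of one of the two
  factors, and the sum over the subgroup can be averaged over translates by the powers of
  that element. Each of these averages is a multiple of a sum of \<open>u\<close> or of \<open>v\<close> that vanishes.
\<close>

text \<open>
  The exponent \<open>n\<close> is any multiple of the order of \<open>g\<close>, as the homomorphisms in the
  transform may fail to be injective. This also makes the condition easy to use in a product, where
  a component of \<open>g\<close> satisfies \<open>g\<^sup>n = 1\<close> but can have smaller order than \<open>g\<close>.
\<close>
definition radon_kernel :: "('a, 'b) monoid_scheme \<Rightarrow> ('a \<Rightarrow> complex) set" where
  "radon_kernel G =
     {f. \<forall>n::nat. \<forall>g \<in> carrier G. n \<ge> 2 \<longrightarrow> g [^]\<^bsub>G\<^esub> n = \<one>\<^bsub>G\<^esub> \<longrightarrow> g \<noteq> \<one>\<^bsub>G\<^esub> \<longrightarrow>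
           (\<forall>x \<in> carrier G. (\<Sum>t<n. f (x \<otimes>\<^bsub>G\<^esub> g [^]\<^bsub>G\<^esub> t)) = 0)}"

lemma radon_kernelD:
  fixes n :: nat
  assumes "f \<in> radon_kernel G" "n \<ge> 2" "g \<in> carrier G" "g [^]\<^bsub>G\<^esub> n = \<one>\<^bsub>G\<^esub>" "g \<noteq> \<one>\<^bsub>G\<^esub>"
    and "x \<in> carrier G"
  shows "(\<Sum>t<n. f (x \<otimes>\<^bsub>G\<^esub> g [^]\<^bsub>G\<^esub> t)) = 0"
  using assms unfolding radon_kernel_def by blast

lemma radon_n_eq_sum_powers:
  fixes G (structure)
  assumes "group G" and n: "n \<ge> 2" and h: "\<gamma> \<in> hom (integer_mod_group n) G"
  shows "radon_n n G f x \<gamma> = (\<Sum>t<n. f (x \<otimes> \<gamma> 1 [^] t))"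
proof -
  have pow: "\<gamma> (int t) = \<gamma> 1 [^] t" if "t < n" for t :: nat
  proof -
    have "\<gamma> (1 [^]\<^bsub>integer_mod_group n\<^esub> t) = \<gamma> 1 [^] t"
      using n \<open>group G\<close> h by (intro hom_nat_pow) (auto simp: carrier_integer_mod_group)
    with that n show ?thesis by simp
  qed
  have "carrier (integer_mod_group n) = int ` {..<n}"
    using n by (simp add: carrier_integer_mod_group image_int_atLeastLessThan lessThan_atLeast0)
  then have "radon_n n G f x \<gamma> = (\<Sum>t<n. f (x \<otimes> \<gamma> (int t)))"
    by (simp add: radon_n_def sum.reindex)
  with pow show ?thesis by simp
qed

lemma nontrivial_homs_generator:
  fixes G (structure)
  assumes "group G" and n: "n \<ge> 2" and \<gamma>: "\<gamma> \<in> nontrivial_homs n G"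
  shows "\<gamma> 1 \<in> carrier G" "\<gamma> 1 [^] n = \<one>" "\<gamma> 1 \<noteq> \<one>"
proof -
  interpret group G by fact
  have h: "\<gamma> \<in> hom (integer_mod_group n) G" using \<gamma> by (simp add: nontrivial_homs_def)
  have pow: "\<gamma> (1 [^]\<^bsub>integer_mod_group n\<^esub> t) = \<gamma> 1 [^] t" for t :: nat
    using n \<open>group G\<close> h by (intro hom_nat_pow) (auto simp: carrier_integer_mod_group)
  show "\<gamma> 1 \<in> carrier G" using h n by (auto simp: hom_def carrier_integer_mod_group)
  have "\<gamma> 0 = \<one>" using hom_one[OF h] \<open>group G\<close> by simp
  with pow[of n] n show "\<gamma> 1 [^] n = \<one>" by simp
  show "\<gamma> 1 \<noteq> \<one>"
  proof
    assume 1: "\<gamma> 1 = \<one>"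
    obtain t where t: "t \<in> carrier (integer_mod_group n)" "\<gamma> t \<noteq> \<one>"
      using \<gamma> by (auto simp: nontrivial_homs_def)
    with pow[of "nat t"] n 1 show False by (simp add: carrier_integer_mod_group)
  qed
qed

lemma nontrivial_hom_of_generator:
  fixes G (structure)
  assumes "group G" and n: "n \<ge> 2" and g: "g \<in> carrier G" "g [^] n = \<one>" "g \<noteq> \<one>"
  obtains \<gamma> where "\<gamma> \<in> nontrivial_homs n G" "\<gamma> 1 = g"
proof
  interpret group G by fact
  define \<gamma> where "\<gamma> = restrict (\<lambda>t::int. g [^] t) (carrier (integer_mod_group n))"
  have "int (ord g) dvd int n" using g by (simp add: pow_eq_id)
  then have periodic: "g [^] ((s + t) mod int n) = g [^] (s + t)" for s t :: int
    using g(1) by (simp add: int_pow_eq mod_eq_dvd_iff[symmetric] mod_mod_cancel)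
  have "\<gamma> \<in> hom (integer_mod_group n) G"
    using n g(1) by (auto simp: hom_def \<gamma>_def carrier_integer_mod_group periodic int_pow_mult)
  moreover show "\<gamma> 1 = g"
    using n g(1) by (simp add: \<gamma>_def carrier_integer_mod_group)
  moreover have "1 \<in> carrier (integer_mod_group n)"
    using n by (simp add: carrier_integer_mod_group)
  ultimately show "\<gamma> \<in> nontrivial_homs n G"
    using g(3) by (auto simp: nontrivial_homs_def \<gamma>_def intro!: bexI[of _ 1])
qed

lemma radon_injective_iff_kernel_trivial:
  assumes "group G"
  shows "radon_injective G \<longleftrightarrow> (\<forall>f \<in> radon_kernel G. \<forall>x \<in> carrier G. f x = 0)"
proof -
  have "(\<forall>n \<ge> 2. \<forall>x \<in> carrier G. \<forall>\<gamma> \<in> nontrivial_homs n G. radon_n n G f x \<gamma> = 0)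
          \<longleftrightarrow> f \<in> radon_kernel G" (is "?L \<longleftrightarrow> ?R") for f :: "'a \<Rightarrow> complex"
  proof
    assume L: ?L
    have "(\<Sum>t<n. f (x \<otimes>\<^bsub>G\<^esub> g [^]\<^bsub>G\<^esub> t)) = 0"
      if n: "n \<ge> 2" and g: "g \<in> carrier G" "g [^]\<^bsub>G\<^esub> n = \<one>\<^bsub>G\<^esub>" "g \<noteq> \<one>\<^bsub>G\<^esub>" and x: "x \<in> carrier G"
      for n :: nat and g x
    proof -
      obtain \<gamma> where "\<gamma> \<in> nontrivial_homs n G" "\<gamma> 1 = g"
        using nontrivial_hom_of_generator[OF assms n g] .
      with L n x radon_n_eq_sum_powers[OF assms n, of \<gamma> f x] show ?thesis
        by (simp add: nontrivial_homs_def)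
    qed
    then show ?R by (simp add: radon_kernel_def)
  next
    assume R: ?R
    show ?L
    proof (intro allI impI ballI)
      fix n :: nat and x \<gamma>
      assume n: "n \<ge> 2" and x: "x \<in> carrier G" and \<gamma>: "\<gamma> \<in> nontrivial_homs n G"
      show "radon_n n G f x \<gamma> = 0"
        using radon_kernelD[OF R n nontrivial_homs_generator[OF assms n \<gamma>] x] \<gamma>
          radon_n_eq_sum_powers[OF assms n, of \<gamma> f x]
        by (simp add: nontrivial_homs_def)
    qed
  qed
  then show ?thesis by (auto simp: radon_injective_def)
qed

text \<open>
  The lines through \<open>x\<close> in the plane spanned by \<open>a\<close> and \<open>b\<close>, other than the one in direction \<open>b\<close>,
  have directions \<open>ab\<^sup>k\<close> with \<open>k < p\<close>. Sum \<open>f\<close> over all of them and exchange the sums: for fixed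
  \<open>t \<noteq> 0\<close> the points \<open>x(ab\<^sup>k)\<^sup>t = xa\<^sup>t(b\<^sup>t)\<^sup>k\<close> run through a line in direction \<open>b\<^sup>t \<noteq> 1\<close>,
  so only \<open>t = 0\<close> contributes, and it contributes \<open>p f(x)\<close>.
\<close>
lemma radon_kernel_vanishes_if_rank_two:
  fixes G (structure) and p :: nat
  assumes "group G" and f: "f \<in> radon_kernel G" and p: "prime p"
    and a: "a \<in> carrier G" "a [^] p = \<one>" and b: "b \<in> carrier G" "b [^] p = \<one>" "b \<noteq> \<one>"
    and comm: "a \<otimes> b = b \<otimes> a" and indep: "\<And>k::nat. a \<otimes> b [^] k \<noteq> \<one>"
    and x: "x \<in> carrier G"
  shows "f x = 0"
proof -
  interpret group G by fact
  have p2: "p \<ge> 2" using p by (rule prime_ge_2_nat)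
  have comm_pow: "a \<otimes> b [^] k = b [^] k \<otimes> a" for k :: nat
    using group_commutes_pow[OF comm[symmetric] b(1) a(1)] by simp
  have line: "(a \<otimes> b [^] k) [^] t = a [^] t \<otimes> (b [^] t) [^] k" for k t :: nat
    using a(1) b(1) pow_mult_distrib[OF comm_pow] by (simp add: nat_pow_pow mult.commute)
  have b_pow: "b [^] t \<noteq> \<one>" if "0 < t" "t < p" for t
  proof -
    have "ord b dvd p" using b by (simp add: pow_eq_id)
    with p b have "ord b = p" by (metis ord_eq_1 prime_nat_iff)
    with that b show ?thesis by (simp add: pow_eq_id nat_dvd_not_less)
  qed
  have "0 = (\<Sum>k<p. \<Sum>t<p. f (x \<otimes> (a \<otimes> b [^] k) [^] t))"
    by (intro sum.neutral[symmetric] ballI radon_kernelD[OF f p2])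
      (use a b x indep in \<open>auto simp: line nat_pow_pow mult.commute[of _ p] simp flip: nat_pow_pow[of _ p]\<close>)
  also have "\<dots> = (\<Sum>t<p. \<Sum>k<p. f (x \<otimes> a [^] t \<otimes> (b [^] t) [^] k))"
    by (subst sum.swap) (use a b x in \<open>simp add: line m_assoc\<close>)
  also have "\<dots> = (\<Sum>t<p. if t = 0 then of_nat p * f x else 0)"
  proof (intro sum.cong refl)
    fix t assume "t \<in> {..<p}"
    show "(\<Sum>k<p. f (x \<otimes> a [^] t \<otimes> (b [^] t) [^] k)) = (if t = 0 then of_nat p * f x else 0)"
    proof (cases "t = 0")
      case True then show ?thesis using x by simp
    next
      case False
      have "(b [^] t) [^] p = \<one>"
        using b by (metis mult.commute nat_pow_one nat_pow_pow)
      with False \<open>t \<in> {..<p}\<close> show ?thesis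
        using a b x b_pow by (simp add: radon_kernelD[OF f p2])
    qed
  qed
  also have "\<dots> = of_nat p * f x"
    using p2 by (simp add: sum.delta)
  finally show ?thesis using p2 by simp
qed

lemma DirProd_nat_pow:
  fixes n :: nat
  shows "(a, b) [^]\<^bsub>G \<times>\<times> H\<^esub> n = (a [^]\<^bsub>G\<^esub> n, b [^]\<^bsub>H\<^esub> n)"
  by (induction n) (simp_all add: nat_pow_def)

text \<open>Cauchy's theorem, as the case of Sylow's theorem for subgroups of order \<open>p\<^sup>1\<close>.\<close>
lemma (in group) exists_element_of_prime_order:
  assumes fin: "finite (carrier G)" and p: "prime p" "p dvd order G"
  obtains a where "a \<in> carrier G" "a [^] p = \<one>" "a \<noteq> \<one>"
proof -
  obtain m where "order G = p ^ 1 * m" using p(2) by auto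
  then obtain H where H: "subgroup H G" "card H = p ^ 1"
    using sylow_thm[OF p(1) group_axioms _ fin] by blast
  then have card: "card H = p" by simp
  have "H \<noteq> {\<one>}" using card p(1) by auto
  then obtain a where a: "a \<in> H" "a \<noteq> \<one>" using subgroup.one_closed[OF H(1)] by blast
  interpret H: group "G\<lparr>carrier := H\<rparr>" using H(1) by (rule subgroup_imp_group)
  have "a [^]\<^bsub>G\<lparr>carrier := H\<rparr>\<^esub> order (G\<lparr>carrier := H\<rparr>) = \<one>\<^bsub>G\<lparr>carrier := H\<rparr>\<^esub>"
    using a(1) by (intro H.pow_order_eq_1) simp
  then have "a [^] p = \<one>" by (simp add: order_def card nat_pow_consistent[symmetric])
  with a H(1) show thesis by (auto intro: that dest: subgroup.mem_carrier)
qed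

lemma radon_kernel_fst_slice:
  assumes "group H" and f: "f \<in> radon_kernel (G \<times>\<times> H)" and y: "y \<in> carrier H"
  shows "(\<lambda>x. f (x, y)) \<in> radon_kernel G"
proof -
  interpret H: group H by fact
  have "(\<Sum>t<n. f (x \<otimes>\<^bsub>G\<^esub> g [^]\<^bsub>G\<^esub> t, y)) = 0"
    if "n \<ge> 2" "g \<in> carrier G" "g [^]\<^bsub>G\<^esub> n = \<one>\<^bsub>G\<^esub>" "g \<noteq> \<one>\<^bsub>G\<^esub>" "x \<in> carrier G" for n :: nat and g x
    using radon_kernelD[OF f that(1), of "(g, \<one>\<^bsub>H\<^esub>)" "(x, y)"] that y
    by (simp add: DirProd_nat_pow)
  then show ?thesis by (simp add: radon_kernel_def)
qed

lemma radon_kernel_snd_slice: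
  assumes "group G" and f: "f \<in> radon_kernel (G \<times>\<times> H)" and x: "x \<in> carrier G"
  shows "(\<lambda>y. f (x, y)) \<in> radon_kernel H"
proof -
  interpret G: group G by fact
  have "(\<Sum>t<n. f (x, y \<otimes>\<^bsub>H\<^esub> h [^]\<^bsub>H\<^esub> t)) = 0"
    if "n \<ge> 2" "h \<in> carrier H" "h [^]\<^bsub>H\<^esub> n = \<one>\<^bsub>H\<^esub>" "h \<noteq> \<one>\<^bsub>H\<^esub>" "y \<in> carrier H" for n :: nat and h y
    using radon_kernelD[OF f that(1), of "(\<one>\<^bsub>G\<^esub>, h)" "(x, y)"] that x
    by (simp add: DirProd_nat_pow)
  then show ?thesis by (simp add: radon_kernel_def)
qed

lemma sum_periodic_shift:
  fixes F :: "nat \<Rightarrow> 'a::ab_group_add"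
  assumes "\<And>t. F (t + n) = F t"
  shows "(\<Sum>t<n. F (t + d)) = (\<Sum>t<n. F t)"
proof (induction d)
  case (Suc d)
  have "(\<Sum>t<n. F (Suc t + d)) + F d = (\<Sum>t<n. F (t + d)) + F (n + d)"
    using sum.lessThan_Suc_shift[of "\<lambda>t. F (t + d)" n] by (simp add: add.commute)
  also have "F (n + d) = F d" using assms[of d] by (simp add: add.commute)
  finally show ?case using Suc by simp
qed simp

text \<open>
  It suffices to control the direction of one power of \<open>g\<close>: the sum over the powers of \<open>g\<close> does
  not change when the exponents are shifted by \<open>dr\<close>, so \<open>n\<close> times it is the total of the \<open>n\<close> shifted
  sums, which regroup into sums in direction \<open>g\<^sup>d\<close>.
\<close>
lemma sum_powers_eq_zero_if_power_direction:
  fixes G (structure) and f :: "'a \<Rightarrow> complex" and n d :: nat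
  assumes "group G" and g: "g \<in> carrier G" "g [^] n = \<one>" and x: "x \<in> carrier G"
    and zero: "\<And>y. y \<in> carrier G \<Longrightarrow> (\<Sum>r<n. f (y \<otimes> (g [^] d) [^] r)) = 0"
  shows "(\<Sum>t<n. f (x \<otimes> g [^] t)) = 0"
proof (cases "n = 0")
  case False
  interpret group G by fact
  have periodic: "f (x \<otimes> g [^] (t + n)) = f (x \<otimes> g [^] t)" for t
    using g by (simp flip: nat_pow_mult)
  have "of_nat n * (\<Sum>t<n. f (x \<otimes> g [^] t)) = (\<Sum>r<n. \<Sum>t<n. f (x \<otimes> g [^] (t + d * r)))"
    using sum_periodic_shift[of "\<lambda>t. f (x \<otimes> g [^] t)" n, OF periodic] by simp
  also have "\<dots> = (\<Sum>t<n. \<Sum>r<n. f (x \<otimes> g [^] t \<otimes> (g [^] d) [^] r))"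
    by (subst sum.swap) (use g x in \<open>simp add: nat_pow_pow m_assoc flip: nat_pow_mult\<close>)
  also have "\<dots> = 0"
    using g x by (simp add: zero)
  finally show ?thesis using False by simp
qed simp

lemma (in group) pow_coprime_order_neq_one:
  assumes "finite (carrier G)" "g \<in> carrier G" "g \<noteq> \<one>" "coprime (order G) m"
  shows "g [^] m \<noteq> \<one>"
proof
  assume "g [^] m = \<one>"
  then have "ord g dvd m" "ord g dvd order G"
    using assms by (simp_all add: pow_eq_id ord_dvd_group_order)
  with assms(4) have "ord g = 1" by (metis coprime_common_divisor_nat)
  with assms show False using ord_eq_1 by blast
qed

text \<open>
  Let \<open>(g, h)\<close> be the direction. If \<open>g = 1\<close>, the sum is a multiple of a sum of \<open>v\<close>. Otherwise the
  power of \<open>(g, h)\<close> to the order of the second group kills \<open>h\<close> but, by coprimality, not \<open>g\<close>,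
  so along this power the sum is a multiple of a sum of \<open>u\<close>.
\<close>
lemma radon_kernel_tensor:
  assumes G: "group G" "finite (carrier G)" and H: "group H"
    and cop: "coprime (order G) (order H)"
    and u: "u \<in> radon_kernel G" and v: "v \<in> radon_kernel H"
  shows "(\<lambda>(x, y). u x * v y) \<in> radon_kernel (G \<times>\<times> H)"
proof -
  interpret G: group G by fact
  interpret H: group H by fact
  let ?f = "\<lambda>(x, y). u x * v y"
  have "(\<Sum>t<n. ?f (z \<otimes>\<^bsub>G \<times>\<times> H\<^esub> c [^]\<^bsub>G \<times>\<times> H\<^esub> t)) = 0"
    if n: "n \<ge> 2" and c: "c \<in> carrier (G \<times>\<times> H)" "c [^]\<^bsub>G \<times>\<times> H\<^esub> n = \<one>\<^bsub>G \<times>\<times> H\<^esub>" "c \<noteq> \<one>\<^bsub>G \<times>\<times> H\<^esub>"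
      and z: "z \<in> carrier (G \<times>\<times> H)" for n :: nat and c z
  proof -
    obtain g h where gh: "c = (g, h)" by fastforce
    have g: "g \<in> carrier G" "g [^]\<^bsub>G\<^esub> n = \<one>\<^bsub>G\<^esub>" and h: "h \<in> carrier H" "h [^]\<^bsub>H\<^esub> n = \<one>\<^bsub>H\<^esub>"
      using c by (simp_all add: gh DirProd_nat_pow)
    note reduce = sum_powers_eq_zero_if_power_direction[OF DirProd_group[OF G(1) H] c(1,2) z]
    show ?thesis
    proof (cases "g = \<one>\<^bsub>G\<^esub>")
      case False
      let ?a = "g [^]\<^bsub>G\<^esub> order H"
      have power: "c [^]\<^bsub>G \<times>\<times> H\<^esub> order H = (?a, \<one>\<^bsub>H\<^esub>)"
        using h(1) by (simp add: gh DirProd_nat_pow H.pow_order_eq_1)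
      have a: "?a \<in> carrier G" "?a [^]\<^bsub>G\<^esub> n = \<one>\<^bsub>G\<^esub>" "?a \<noteq> \<one>\<^bsub>G\<^esub>"
        using g False G.pow_coprime_order_neq_one[OF G(2) g(1) False cop]
        by (simp, metis G.nat_pow_one G.nat_pow_pow mult.commute, simp)
      show ?thesis
        by (rule reduce[of _ "order H"])
          (auto simp: power DirProd_nat_pow radon_kernelD[OF u n a] simp flip: sum_distrib_right)
    next
      case True
      then have h1: "h \<noteq> \<one>\<^bsub>H\<^esub>" using c(3) gh by simp
      show ?thesis
        using True radon_kernelD[OF v n h h1] z
        by (auto simp: gh DirProd_nat_pow simp flip: sum_distrib_left)
    qed
  qed
  then show ?thesis unfolding radon_kernel_def by blast
qed

theorem theorem4p1:
  fixes G1 :: "('a, 'c) monoid_scheme" and G2 :: "('b, 'd) monoid_scheme"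
  assumes "group G1" and "finite (carrier G1)"
    and "group G2" and "finite (carrier G2)"
  shows "\<not> radon_injective (G1 \<times>\<times> G2) \<longleftrightarrow>
           \<not> radon_injective G1 \<and> \<not> radon_injective G2 \<and> coprime (order G1) (order G2)"
proof -
  interpret G1: group G1 by fact
  interpret G2: group G2 by fact
  have P: "group (G1 \<times>\<times> G2)" using assms by (intro DirProd_group)
  note inj_iff = radon_injective_iff_kernel_trivial
  show ?thesis
  proof
    assume "\<not> radon_injective (G1 \<times>\<times> G2)"
    then obtain f x y where f: "f \<in> radon_kernel (G1 \<times>\<times> G2)"
      and xy: "x \<in> carrier G1" "y \<in> carrier G2" and nz: "f (x, y) \<noteq> 0"
      by (auto simp: inj_iff[OF P])
    have "\<not> radon_injective G1"
      using radon_kernel_fst_slice[OF assms(3) f xy(2)] xy(1) nz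
      by (auto simp: inj_iff[OF assms(1)])
    moreover have "\<not> radon_injective G2"
      using radon_kernel_snd_slice[OF assms(1) f xy(1)] xy(2) nz
      by (auto simp: inj_iff[OF assms(3)])
    moreover have "coprime (order G1) (order G2)"
    proof (rule ccontr)
      assume "\<not> coprime (order G1) (order G2)"
      then obtain p where p: "prime p" "p dvd order G1" "p dvd order G2"
        by (metis coprime_iff_gcd_eq_1 gcd_nat.bounded_iff prime_factor_nat)
      obtain a where a: "a \<in> carrier G1" "a [^]\<^bsub>G1\<^esub> p = \<one>\<^bsub>G1\<^esub>" "a \<noteq> \<one>\<^bsub>G1\<^esub>"
        using G1.exists_element_of_prime_order[OF assms(2) p(1,2)] .
      obtain b where b: "b \<in> carrier G2" "b [^]\<^bsub>G2\<^esub> p = \<one>\<^bsub>G2\<^esub>" "b \<noteq> \<one>\<^bsub>G2\<^esub>"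
        using G2.exists_element_of_prime_order[OF assms(4) p(1,3)] .
      have "f (x, y) = 0"
        by (rule radon_kernel_vanishes_if_rank_two
              [OF P f p(1), of "(a, \<one>\<^bsub>G2\<^esub>)" "(\<one>\<^bsub>G1\<^esub>, b)"])
          (use a b xy in \<open>simp_all add: DirProd_nat_pow\<close>)
      with nz show False ..
    qed
    ultimately show "\<not> radon_injective G1 \<and> \<not> radon_injective G2 \<and> coprime (order G1) (order G2)"
      by blast
  next
    assume R: "\<not> radon_injective G1 \<and> \<not> radon_injective G2 \<and> coprime (order G1) (order G2)"
    then obtain u x where u: "u \<in> radon_kernel G1" "x \<in> carrier G1" "u x \<noteq> 0"
      by (auto simp: inj_iff[OF assms(1)])
    from R obtain v y where v: "v \<in> radon_kernel G2" "y \<in> carrier G2" "v y \<noteq> 0"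
      by (auto simp: inj_iff[OF assms(3)])
    have "(\<lambda>(x, y). u x * v y) \<in> radon_kernel (G1 \<times>\<times> G2)"
      using radon_kernel_tensor[OF assms(1-3) _ u(1) v(1)] R by blast
    moreover have "(x, y) \<in> carrier (G1 \<times>\<times> G2)" "(\<lambda>(x, y). u x * v y) (x, y) \<noteq> 0"
      using u v by simp_all
    ultimately show "\<not> radon_injective (G1 \<times>\<times> G2)"
      unfolding inj_iff[OF P] by blast
  qed
qed

end
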